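(* Consider edge-weighted online stochastic matching with arbitrary (possibly non-integral) arrival rates and stochastic rewards (defined in the context). Let $\{f_e\}$ be an optimal solution of the linear program $$\max \sum_{e\in E} w_e f_e p_e \quad\text{s.t.}\quad \sum_{e\in\partial(u)} f_e p_e\le 1\ \ \forall u\in U,\qquad \sum_{e\in\partial(v)} f_e\le r_v\ \ \forall v\in V,\qquad f_e\ge 0,$$ where $\partial(w)$ is the set of edges incident to $w$. The algorithm $\mathsf{SM}$ which, whenever a vertex $v$ arrives, chooses a neighbor $u$ with probability $f_{(u,v)}/r_v$ (and no neighbor with the remaining probability) and assigns (probes) $v$ to $u$ if $u$ is still unmatched, achieves competitive ratio $1-1/e$; moreover, this is optimal among all non-adaptive algorithms, i.e. no non-adaptive algorithm achieves a competitive ratio better than $1-1/e$ in this model.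
   Context: Model: bipartite graph $G=(U,V,E)$, $U$ offline. Each $v\in V$ has an arrival rate $r_v>0$ (not necessarily integral) with $\sum_v r_v=n$, where $n$ is the number of online rounds; in each round a vertex $v$ is drawn independently with probability $r_v/n$. Each edge $e$ has weight $w_e\ge 0$ and probability $p_e\in(0,1]$. When an arriving $v$ is assigned (probed) to an available neighbor $u$ via edge $e=(u,v)$, independently of everything else the edge is present with probability $p_e$, in which case $u$ becomes matched and the reward $w_e$ is obtained; otherwise no reward is obtained for this arrival. Each $u$ can be matched at most once, and each arrival is assigned at most once, immediately and irrevocably. An algorithm is non-adaptive if it specifies all its online actions before the online phase (not depending on the realized arrivals so far); adaptive algorithms may depend on the realizations so far. The competitive ratio is $\mathbb{E}[\mathrm{ALG}]/\mathbb{E}[\mathrm{OPT}]$, with $\mathrm{OPT}$ the expected value of the optimal offline solution, analyzed asymptotically as $n\to\infty$. *)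

theory Defs
  imports "HOL-Probability.Probability"
begin

record ('u, 'v) osm =
  offline :: "'u set"
  online :: "'v set"
  edges :: "('u \<times> 'v) set"
  rate :: "'v \<Rightarrow> real"
  weight :: "'u \<times> 'v \<Rightarrow> real"
  edge_prob :: "'u \<times> 'v \<Rightarrow> real"
  rounds :: nat

definition valid_osm :: "('u, 'v) osm \<Rightarrow> bool" where
  "valid_osm I \<longleftrightarrow>
     finite (offline I) \<and> finite (online I) \<and> edges I \<subseteq> offline I \<times> online I \<and>
     0 < rounds I \<and>
     (\<forall>v\<in>online I. 0 < rate I v) \<and> (\<Sum>v\<in>online I. rate I v) = real (rounds I) \<and>
     (\<forall>e\<in>edges I. 0 \<le> weight I e \<and> 0 < edge_prob I e \<and> edge_prob I e \<le> 1)"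

definition arrival :: "('u, 'v) osm \<Rightarrow> 'v pmf" where
  "arrival I = embed_pmf (\<lambda>v. if v \<in> online I then rate I v / real (rounds I) else 0)"

lemma pmf_arrival:
  assumes "valid_osm I"
  shows "pmf (arrival I) v = (if v \<in> online I then rate I v / real (rounds I) else 0)"
proof -
  let ?g = "\<lambda>v. if v \<in> online I then rate I v / real (rounds I) else 0"
  have fin: "finite (online I)" and nn: "\<And>v. 0 \<le> ?g v"
    using assms by (auto simp: valid_osm_def less_imp_le)
  have "(\<integral>\<^sup>+v. ennreal (?g v) \<partial>count_space UNIV) = (\<Sum>v\<in>online I. ennreal (?g v))"
    by (rule nn_integral_count_space'[OF fin]) auto
  also have "\<dots> = ennreal (\<Sum>v\<in>online I. ?g v)"
    using nn by (intro sum_ennreal) blast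
  also have "(\<Sum>v\<in>online I. ?g v) = 1"
    using assms by (simp add: valid_osm_def flip: sum_divide_distrib)
  finally show ?thesis
    unfolding arrival_def using nn by (subst pmf_embed_pmf) auto
qed

subsection \<open>Online algorithms\<close>

text \<open>
  One event per completed round: the arriving vertex, the offline vertex selected for it (if any),
  and whether the arrival was probed and the probed edge turned out to be present.
\<close>
type_synonym ('u, 'v) event = "'v \<times> 'u option \<times> bool"

type_synonym ('u, 'v) policy = "('u, 'v) event list \<Rightarrow> 'v \<Rightarrow> 'u option pmf"

text \<open>
  A policy maps the history and the arriving vertex to a selection, using fresh randomness in each
  round.  An algorithm is a distribution over policies, which adds randomness that is drawn before
  the first round and may correlate the selections of different rounds.
\<close>
type_synonym ('u, 'v) algorithm = "('u, 'v) policy pmf"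

definition matched :: "('u, 'v) event list \<Rightarrow> 'u set" where
  "matched h = {u. \<exists>v. (v, Some u, True) \<in> set h}"

text \<open>Selecting a matched vertex or a non-neighbour has no effect.\<close>
definition probe ::
  "('u, 'v) osm \<Rightarrow> ('u, 'v) event list \<Rightarrow> 'v \<Rightarrow> 'u option \<Rightarrow> bool pmf" where
  "probe I h v c =
     (case c of
        None \<Rightarrow> return_pmf False
      | Some u \<Rightarrow>
          if (u, v) \<in> edges I \<and> u \<notin> matched h then bernoulli_pmf (edge_prob I (u, v))
          else return_pmf False)"

primrec run :: "('u, 'v) osm \<Rightarrow> ('u, 'v) policy \<Rightarrow> nat \<Rightarrow> ('u, 'v) event list pmf" where
  "run I \<pi> 0 = return_pmf []"
| "run I \<pi> (Suc t) =
     do {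
       h \<leftarrow> run I \<pi> t;
       v \<leftarrow> arrival I;
       c \<leftarrow> \<pi> h v;
       b \<leftarrow> probe I h v c;
       return_pmf (h @ [(v, c, b)])
     }"

definition reward :: "('u, 'v) osm \<Rightarrow> ('u, 'v) event list \<Rightarrow> real" where
  "reward I h = (\<Sum>(v, c, b)\<leftarrow>h. if b then weight I (the c, v) else 0)"

definition expected_alg :: "('u, 'v) osm \<Rightarrow> ('u, 'v) algorithm \<Rightarrow> real" where
  "expected_alg I A =
     measure_pmf.expectation (bind_pmf A (\<lambda>\<pi>. run I \<pi> (rounds I))) (reward I)"

text \<open>
  The selection may depend on the round (the length of the history), the currently arriving
  vertex and randomness, but not on the arrivals and probing outcomes of the earlier rounds.
\<close>
definition nonadaptive :: "('u, 'v) algorithm \<Rightarrow> bool" where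
  "nonadaptive A \<longleftrightarrow>
     (\<forall>\<pi>\<in>set_pmf A. \<forall>h h' v. length h = length h' \<longrightarrow> \<pi> h v = \<pi> h' v)"

subsection \<open>The offline optimum\<close>

text \<open>
  The offline solution knows the whole arrival sequence, but learns whether an edge is present only
  by probing it.  \<open>Probe i u s s'\<close> assigns the \<open>i\<close>-th arrival to \<open>u\<close> and continues with \<open>s\<close> if the
  edge is present and with \<open>s'\<close> otherwise; the arrivals may be processed in any order.
\<close>
datatype 'u strategy = Stop | Probe nat 'u "'u strategy" "'u strategy"

text \<open>\<open>R\<close> is the set of arrivals not yet assigned and \<open>A\<close> the set of unmatched offline vertices.\<close>
primrec feasible_strategy ::
  "('u, 'v) osm \<Rightarrow> 'v list \<Rightarrow> 'u strategy \<Rightarrow> nat set \<Rightarrow> 'u set \<Rightarrow> bool" where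
  "feasible_strategy I vs Stop R A \<longleftrightarrow> True"
| "feasible_strategy I vs (Probe i u s s') R A \<longleftrightarrow>
     i \<in> R \<and> u \<in> A \<and> (u, vs ! i) \<in> edges I \<and>
     feasible_strategy I vs s (R - {i}) (A - {u}) \<and>
     feasible_strategy I vs s' (R - {i}) A"

primrec strategy_value :: "('u, 'v) osm \<Rightarrow> 'v list \<Rightarrow> 'u strategy \<Rightarrow> real" where
  "strategy_value I vs Stop = 0"
| "strategy_value I vs (Probe i u s s') =
     edge_prob I (u, vs ! i) * (weight I (u, vs ! i) + strategy_value I vs s) +
     (1 - edge_prob I (u, vs ! i)) * strategy_value I vs s'"

definition offline_opt :: "('u, 'v) osm \<Rightarrow> 'v list \<Rightarrow> real" where
  "offline_opt I vs =
     Sup {strategy_value I vs s | s. feasible_strategy I vs s {..<length vs} (offline I)}"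

definition expected_opt :: "('u, 'v) osm \<Rightarrow> real" where
  "expected_opt I =
     measure_pmf.expectation (replicate_pmf (rounds I) (arrival I)) (offline_opt I)"

text \<open>
  The ratio of \<open>expected_alg\<close> to \<open>expected_opt\<close> is at least \<open>c\<close> up to a term that vanishes as the
  number of rounds grows, uniformly over all instances; multiplying out covers optimum \<open>0\<close>.
\<close>
definition achieves_ratio :: "(('u, 'v) osm \<Rightarrow> ('u, 'v) algorithm) \<Rightarrow> real \<Rightarrow> bool" where
  "achieves_ratio alg c \<longleftrightarrow>
     (\<forall>\<epsilon>>0. \<exists>N. \<forall>I. valid_osm I \<and> N \<le> rounds I \<longrightarrow>
        (c - \<epsilon>) * expected_opt I \<le> expected_alg I (alg I))"

subsection \<open>The linear program and the algorithm SM\<close>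

definition lp_feasible :: "('u, 'v) osm \<Rightarrow> ('u \<times> 'v \<Rightarrow> real) \<Rightarrow> bool" where
  "lp_feasible I f \<longleftrightarrow>
     (\<forall>u\<in>offline I. (\<Sum>e | e \<in> edges I \<and> fst e = u. f e * edge_prob I e) \<le> 1) \<and>
     (\<forall>v\<in>online I. (\<Sum>e | e \<in> edges I \<and> snd e = v. f e) \<le> rate I v) \<and>
     (\<forall>e\<in>edges I. 0 \<le> f e)"

definition lp_value :: "('u, 'v) osm \<Rightarrow> ('u \<times> 'v \<Rightarrow> real) \<Rightarrow> real" where
  "lp_value I f = (\<Sum>e\<in>edges I. weight I e * f e * edge_prob I e)"

definition lp_optimal :: "('u, 'v) osm \<Rightarrow> ('u \<times> 'v \<Rightarrow> real) \<Rightarrow> bool" where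
  "lp_optimal I f \<longleftrightarrow>
     lp_feasible I f \<and> (\<forall>g. lp_feasible I g \<longrightarrow> lp_value I g \<le> lp_value I f)"

definition SM_choice :: "('u, 'v) osm \<Rightarrow> ('u \<times> 'v \<Rightarrow> real) \<Rightarrow> 'v \<Rightarrow> 'u option pmf" where
  "SM_choice I f v =
     embed_pmf (\<lambda>c. case c of
        Some u \<Rightarrow> if (u, v) \<in> edges I then f (u, v) / rate I v else 0
      | None \<Rightarrow> 1 - (\<Sum>u | (u, v) \<in> edges I. f (u, v) / rate I v))"

lemma pmf_SM_choice:
  assumes "valid_osm I" "lp_feasible I f" "v \<in> online I"
  shows "pmf (SM_choice I f v) c =
     (case c of
        Some u \<Rightarrow> if (u, v) \<in> edges I then f (u, v) / rate I v else 0
      | None \<Rightarrow> 1 - (\<Sum>u | (u, v) \<in> edges I. f (u, v) / rate I v))"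
proof -
  let ?N = "{u. (u, v) \<in> edges I}"
  let ?g = "\<lambda>c. case c of
        Some u \<Rightarrow> if (u, v) \<in> edges I then f (u, v) / rate I v else 0
      | None \<Rightarrow> 1 - (\<Sum>u\<in>?N. f (u, v) / rate I v)"
  have fin: "finite ?N"
    using assms(1) by (auto simp: valid_osm_def intro: finite_subset[of _ "offline I"])
  have r: "0 < rate I v"
    using assms by (auto simp: valid_osm_def)
  have "(\<Sum>u\<in>?N. f (u, v)) = (\<Sum>e | e \<in> edges I \<and> snd e = v. f e)"
    by (rule sum.reindex_bij_witness[of _ fst "\<lambda>u. (u, v)"]) auto
  also have "\<dots> \<le> rate I v"
    using assms by (auto simp: lp_feasible_def)
  finally have le: "(\<Sum>u\<in>?N. f (u, v) / rate I v) \<le> 1"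
    using r by (simp add: flip: sum_divide_distrib)
  have nn: "0 \<le> ?g c" for c
    using assms r le by (auto simp: lp_feasible_def split: option.splits)
  have "(\<integral>\<^sup>+c. ennreal (?g c) \<partial>count_space UNIV) =
        (\<Sum>c\<in>insert None (Some ` ?N). ennreal (?g c))"
    by (rule nn_integral_count_space') (use fin in \<open>auto split: option.splits\<close>)
  also have "\<dots> = ennreal (\<Sum>c\<in>insert None (Some ` ?N). ?g c)"
    using nn by (intro sum_ennreal) blast
  also have "(\<Sum>c\<in>insert None (Some ` ?N). ?g c) = 1"
    using fin by (subst sum.insert) (auto simp: sum.reindex)
  finally show ?thesis
    unfolding SM_choice_def using nn by (subst pmf_embed_pmf) auto
qed

definition SM :: "('u, 'v) osm \<Rightarrow> ('u \<times> 'v \<Rightarrow> real) \<Rightarrow> ('u, 'v) algorithm" where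
  "SM I f = return_pmf (\<lambda>h v. SM_choice I f v)"

end

theory Submission
  imports Defs
begin

text \<open>
  Averaging, over the arrival sequences, the expected number of times an offline strategy probes
  each edge gives a feasible point of the linear program, so the optimal LP value bounds the offline
  optimum.  Under SM with \<open>n\<close> rounds, every edge \<open>e\<close> with unmatched offline endpoint \<open>u\<close> succeeds in a
  given round with probability \<open>f e * p e / n\<close>; hence \<open>u\<close> is unmatched after \<open>t\<close> rounds with
  probability at least \<open>(1 - 1 / n) ^ t\<close>, and the geometric sum yields the factor
  \<open>1 - (1 - 1 / n) ^ n \<ge> 1 - 1 / exp 1\<close> on the LP value.

  For optimality, take one online vertex joined to \<open>m\<close> offline vertices, with all weights \<open>1\<close>,
  success probabilities \<open>1 / m\<close> and \<open>m\<^sup>2\<close> rounds.  Offline, always probing an unmatched vertex matches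
  \<open>min (Bin (m\<^sup>2, 1 / m)) m\<close> vertices, which is \<open>m - O (sqrt m)\<close> in expectation.  A non-adaptive
  algorithm has to spread its \<open>m\<^sup>2\<close> probes in advance, and by convexity the even spread with \<open>m\<close>
  probes per vertex is best; it matches only \<open>m * (1 - (1 - 1 / m) ^ m)\<close> vertices in expectation.
\<close>

section \<open>Expectations over bound probability mass functions\<close>

lemma integrable_measure_pmf_bounded_on:
  fixes f :: "'a \<Rightarrow> real"
  assumes "\<And>x. x \<in> set_pmf p \<Longrightarrow> \<bar>f x\<bar> \<le> B"
  shows "integrable (measure_pmf p) f"
  by (rule measure_pmf.integrable_const_bound[where B = B])
     (use assms in \<open>auto simp: AE_measure_pmf_iff\<close>)

text \<open>The tower rule for nonnegative integrals needs no integrability, so the expectations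
  pass through them. Bounds are asked for on the support only, because rewards are controlled only
  on histories that can occur.\<close>

lemma expectation_bind_pmf_bounded:
  fixes f :: "'b \<Rightarrow> real"
  assumes nonneg: "\<And>y. y \<in> set_pmf (bind_pmf p k) \<Longrightarrow> 0 \<le> f y"
    and bound: "\<And>y. y \<in> set_pmf (bind_pmf p k) \<Longrightarrow> f y \<le> B"
  shows "measure_pmf.expectation (bind_pmf p k) f =
           measure_pmf.expectation p (\<lambda>x. measure_pmf.expectation (k x) f)"
proof -
  have int: "integrable (measure_pmf (k x)) f" if "x \<in> set_pmf p" for x
    by (rule integrable_measure_pmf_bounded_on[where B = B])
       (use that nonneg bound in force)
  have nn: "0 \<le> measure_pmf.expectation (k x) f" if "x \<in> set_pmf p" for x
    by (rule integral_nonneg_AE) (use that nonneg in \<open>auto simp: AE_measure_pmf_iff\<close>)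
  have inner: "(\<integral>\<^sup>+y. ennreal (f y) \<partial>k x) = ennreal (measure_pmf.expectation (k x) f)"
    if "x \<in> set_pmf p" for x
    by (rule nn_integral_eq_integral[OF int[OF that]])
       (use that nonneg in \<open>auto simp: AE_measure_pmf_iff\<close>)
  have "measure_pmf.expectation (bind_pmf p k) f =
          enn2real (\<integral>\<^sup>+y. ennreal (f y) \<partial>bind_pmf p k)"
    by (rule integral_eq_nn_integral) (use nonneg in \<open>auto simp: AE_measure_pmf_iff\<close>)
  also have "(\<integral>\<^sup>+y. ennreal (f y) \<partial>bind_pmf p k) =
          (\<integral>\<^sup>+x. ennreal (measure_pmf.expectation (k x) f) \<partial>p)"
    unfolding nn_integral_bind_pmf
    by (rule nn_integral_cong_AE) (use inner in \<open>auto simp: AE_measure_pmf_iff\<close>)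
  also have "enn2real \<dots> = measure_pmf.expectation p (\<lambda>x. measure_pmf.expectation (k x) f)"
    by (rule integral_eq_nn_integral[symmetric]) (use nn in \<open>auto simp: AE_measure_pmf_iff\<close>)
  finally show ?thesis .
qed

lemma pmf_bind_map_Pair:
  "pmf (bind_pmf p (\<lambda>x. map_pmf (Pair x) (k x))) (x, y) = pmf p x * pmf (k x) y"
proof -
  have *: "pmf (map_pmf (Pair x') (k x')) (x, y) = (if x' = x then pmf (k x) y else 0)" for x'
    by (auto simp: pmf_map_inj' inj_on_def pmf_eq_0_set_pmf)
  have "pmf (bind_pmf p (\<lambda>x. map_pmf (Pair x) (k x))) (x, y) =
          measure_pmf.expectation p (\<lambda>x'. if x' = x then pmf (k x) y else 0)"
    by (simp only: pmf_bind *)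
  also have "\<dots> = (\<Sum>x'\<in>{x}. (if x' = x then pmf (k x) y else 0) * pmf p x')"
    by (rule integral_measure_pmf_real) (auto split: if_splits)
  finally show ?thesis by simp
qed

text \<open>Linearity of expectation. With \<open>n\<close> rounds and arrival probability
  \<open>rate I v / n\<close>, vertex \<open>v\<close> arrives \<open>rate I v\<close> times on
  average, the right-hand side of its LP constraint.\<close>

lemma expectation_count_replicate_pmf:
  "measure_pmf.expectation (replicate_pmf n p) (\<lambda>xs. real (length (filter (\<lambda>x. x = a) xs))) =
     real n * pmf p a"
proof (induction n)
  case 0
  show ?case by simp
next
  case (Suc n)
  let ?c = "\<lambda>xs. real (length (filter (\<lambda>x. x = a) xs))"
  let ?R = "replicate_pmf n p"
  have le: "?c xs \<le> real n" if "xs \<in> set_pmf (replicate_pmf n p)" for n xs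
    using that by (auto simp: set_replicate_pmf)
  have int: "integrable (measure_pmf ?R) ?c"
    by (rule integrable_measure_pmf_bounded_on[where B = n]) (use le in auto)
  have "measure_pmf.expectation (replicate_pmf (Suc n) p) ?c =
          measure_pmf.expectation p (\<lambda>x. measure_pmf.expectation (map_pmf ((#) x) ?R) ?c)"
    unfolding replicate_pmf.simps map_pmf_def[symmetric]
    by (rule expectation_bind_pmf_bounded[where B = "Suc n"])
       (use le[of _ "Suc n"] in \<open>auto simp: set_replicate_pmf simp flip: of_nat_Suc\<close>)
  also have "\<dots> = measure_pmf.expectation p (\<lambda>x. indicator {a} x + real n * pmf p a)"
    using Suc int
    by (intro Bochner_Integration.integral_cong) (auto simp: indicator_def)
  also have "\<dots> = real (Suc n) * pmf p a"
    by (subst Bochner_Integration.integral_add)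
       (auto simp: algebra_simps measure_pmf_single intro!: integrable_measure_pmf_bounded_on[where B = 1])
  finally show ?case .
qed

section \<open>The linear program bounds the offline optimum\<close>

lemma finite_edges: "valid_osm I \<Longrightarrow> finite (edges I)"
  unfolding valid_osm_def by (metis finite_cartesian_product finite_subset)

text \<open>The expected number of probes of each edge.\<close>
primrec probe_mass :: "('u, 'v) osm \<Rightarrow> 'v list \<Rightarrow> 'u strategy \<Rightarrow> 'u \<times> 'v \<Rightarrow> real" where
  "probe_mass I vs Stop e = 0"
| "probe_mass I vs (Probe i u s s') e =
     of_bool (e = (u, vs ! i)) + edge_prob I (u, vs ! i) * probe_mass I vs s e +
     (1 - edge_prob I (u, vs ! i)) * probe_mass I vs s' e"

lemma probe_mass_nonneg:
  assumes valid: "valid_osm I"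
  shows "feasible_strategy I vs s R A \<Longrightarrow> 0 \<le> probe_mass I vs s e"
proof (induction s arbitrary: R A)
  case (Probe i u s s')
  then have "0 \<le> edge_prob I (u, vs ! i)" "edge_prob I (u, vs ! i) \<le> 1"
    using valid by (auto simp: valid_osm_def less_imp_le)
  moreover have "0 \<le> probe_mass I vs s e" "0 \<le> probe_mass I vs s' e"
    using Probe.prems by (auto intro: Probe.IH)
  ultimately show ?case by simp
qed simp

text \<open>Whenever an edge is probed, the probe earns its weight times its success probability in
  expectation, so the value is the LP objective at the probe masses.\<close>

lemma strategy_value_eq_sum_probe_mass:
  assumes valid: "valid_osm I"
  shows "feasible_strategy I vs s R A \<Longrightarrow>
     strategy_value I vs s = (\<Sum>e\<in>edges I. weight I e * probe_mass I vs s e * edge_prob I e)"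
proof (induction s arbitrary: R A)
  case (Probe i u s s')
  let ?e = "(u, vs ! i)"
  let ?V = "\<lambda>s. \<Sum>e\<in>edges I. weight I e * probe_mass I vs s e * edge_prob I e"
  have e: "?e \<in> edges I" using Probe.prems by simp
  have "?V (Probe i u s s') =
      (\<Sum>e\<in>edges I. (if e = ?e then weight I e * edge_prob I e else 0) +
         (edge_prob I ?e * (weight I e * probe_mass I vs s e * edge_prob I e) +
          (1 - edge_prob I ?e) * (weight I e * probe_mass I vs s' e * edge_prob I e)))"
    by (rule sum.cong) (auto simp: algebra_simps)
  also have "\<dots> = weight I ?e * edge_prob I ?e + (edge_prob I ?e * ?V s + (1 - edge_prob I ?e) * ?V s')"
    using e finite_edges[OF valid] by (simp add: sum.distrib sum_distrib_left)
  finally show ?case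
    using Probe.IH(1)[of "R - {i}" "A - {u}"] Probe.IH(2)[of "R - {i}" A] Probe.prems
    by (simp add: algebra_simps)
qed simp

text \<open>The sum is the expected number of successful probes at \<open>u\<close>. A success
  removes \<open>u\<close> from \<open>A\<close>; the mass \<open>?p\<close> gained by a probe of
  \<open>u\<close> is exactly what the success branch loses in the induction bound.\<close>

lemma probe_mass_offline_le:
  assumes valid: "valid_osm I"
  shows "feasible_strategy I vs s R A \<Longrightarrow>
     (\<Sum>e | e \<in> edges I \<and> fst e = u. probe_mass I vs s e * edge_prob I e) \<le> of_bool (u \<in> A)"
proof (induction s arbitrary: R A)
  case (Probe i u' s s')
  let ?e = "(u', vs ! i)" let ?p = "edge_prob I ?e"
  let ?D = "{e \<in> edges I. fst e = u}"
  let ?V = "\<lambda>s. \<Sum>e\<in>?D. probe_mass I vs s e * edge_prob I e"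
  have e: "?e \<in> edges I" using Probe.prems by simp
  then have p: "0 \<le> ?p" "?p \<le> 1" using valid by (auto simp: valid_osm_def less_imp_le)
  have "?V (Probe i u' s s') =
      (\<Sum>e\<in>?D. (if e = ?e then edge_prob I e else 0) +
         (?p * (probe_mass I vs s e * edge_prob I e) +
          (1 - ?p) * (probe_mass I vs s' e * edge_prob I e)))"
    by (rule sum.cong) (auto simp: algebra_simps)
  also have "\<dots> = of_bool (u' = u) * ?p + (?p * ?V s + (1 - ?p) * ?V s')"
    using e finite_edges[OF valid] by (simp add: sum.distrib sum_distrib_left)
  also have "\<dots> \<le> of_bool (u' = u) * ?p + (?p * of_bool (u \<in> A - {u'}) + (1 - ?p) * of_bool (u \<in> A))"
    using Probe.prems p
    by (intro add_left_mono add_mono mult_left_mono Probe.IH[where R = "R - {i}"]) simp_all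
  also have "\<dots> \<le> of_bool (u \<in> A)"
    using Probe.prems by auto
  finally show ?case .
qed simp

text \<open>Every probe uses up its arrival whether it succeeds or fails, so both branches obey the
  same bound with \<open>i\<close> removed from \<open>R\<close>.\<close>

lemma probe_mass_online_le:
  assumes valid: "valid_osm I"
  shows "feasible_strategy I vs s R A \<Longrightarrow> finite R \<Longrightarrow>
     (\<Sum>e | e \<in> edges I \<and> snd e = v. probe_mass I vs s e) \<le> real (card {i\<in>R. vs ! i = v})"
proof (induction s arbitrary: R A)
  case (Probe i u' s s')
  let ?e = "(u', vs ! i)" let ?p = "edge_prob I ?e"
  let ?D = "{e \<in> edges I. snd e = v}"
  let ?V = "\<lambda>s. \<Sum>e\<in>?D. probe_mass I vs s e"
  let ?c = "real (card {j \<in> R - {i}. vs ! j = v})"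
  have e: "?e \<in> edges I" using Probe.prems by simp
  then have p: "0 \<le> ?p" "?p \<le> 1" using valid by (auto simp: valid_osm_def less_imp_le)
  have "?V (Probe i u' s s') =
      (\<Sum>e\<in>?D. (if e = ?e then 1 else 0) +
         (?p * probe_mass I vs s e + (1 - ?p) * probe_mass I vs s' e))"
    by (rule sum.cong) auto
  also have "\<dots> = of_bool (vs ! i = v) + (?p * ?V s + (1 - ?p) * ?V s')"
    using e finite_edges[OF valid] by (simp add: sum.distrib sum_distrib_left)
  also have "\<dots> \<le> of_bool (vs ! i = v) + (?p * ?c + (1 - ?p) * ?c)"
    using Probe.prems p
    by (intro add_left_mono add_mono mult_left_mono
        Probe.IH(1)[where A = "A - {u'}"] Probe.IH(2)[where A = A]) simp_all
  also have "\<dots> = of_bool (vs ! i = v) + ?c"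
    by (simp add: algebra_simps)
  also have "\<dots> = real (card {j \<in> R. vs ! j = v})"
  proof (cases "vs ! i = v")
    case True
    then have "{j \<in> R. vs ! j = v} = insert i {j \<in> R - {i}. vs ! j = v}"
      using Probe.prems by auto
    with True Probe.prems show ?thesis by simp
  next
    case False
    then have "{j \<in> R. vs ! j = v} = {j \<in> R - {i}. vs ! j = v}" by auto
    with False show ?thesis by simp
  qed
  finally show ?case .
qed simp

text \<open>Each edge succeeds at most once in expectation, by the constraint at its offline
  endpoint. This crude bound makes the supremum in \<open>offline_opt\<close> meaningful.\<close>

lemma strategy_value_le_sum_weight:
  assumes valid: "valid_osm I" and feas: "feasible_strategy I vs s R A"
  shows "strategy_value I vs s \<le> (\<Sum>e\<in>edges I. weight I e)"
  unfolding strategy_value_eq_sum_probe_mass[OF assms]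
proof (rule sum_mono)
  fix e assume e: "e \<in> edges I"
  then have w: "0 \<le> weight I e" using valid by (auto simp: valid_osm_def)
  have "probe_mass I vs s e * edge_prob I e \<le>
      (\<Sum>e' | e' \<in> edges I \<and> fst e' = fst e. probe_mass I vs s e' * edge_prob I e')"
    using e finite_edges[OF valid] probe_mass_nonneg[OF assms] valid
    by (intro member_le_sum) (auto simp: valid_osm_def less_imp_le)
  also have "\<dots> \<le> 1"
    by (rule order_trans[OF probe_mass_offline_le[OF assms]]) simp
  finally show "weight I e * probe_mass I vs s e * edge_prob I e \<le> weight I e"
    using w by (simp add: mult.assoc mult_left_le)
qed

section \<open>Near-optimal offline strategies and averaging over the arrivals\<close>

lemma bdd_above_strategy_value:
  assumes valid: "valid_osm I"
  shows "bdd_above {strategy_value I vs s | s. feasible_strategy I vs s R A}"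
  by (rule bdd_aboveI[where M = "\<Sum>e\<in>edges I. weight I e"])
     (use strategy_value_le_sum_weight[OF valid] in auto)

lemma strategy_value_le_offline_opt:
  assumes valid: "valid_osm I"
  shows "feasible_strategy I vs s {..<length vs} (offline I) \<Longrightarrow> strategy_value I vs s \<le> offline_opt I vs"
  unfolding offline_opt_def by (rule cSup_upper[OF _ bdd_above_strategy_value[OF valid]]) auto

lemma offline_opt_nonneg:
  assumes valid: "valid_osm I"
  shows "0 \<le> offline_opt I vs"
  using strategy_value_le_offline_opt[OF valid, of vs Stop] by simp

lemma ex_near_optimal_strategy:
  assumes "valid_osm I" "0 < \<epsilon>"
  shows "\<exists>s. feasible_strategy I vs s {..<length vs} (offline I) \<and>
             offline_opt I vs \<le> strategy_value I vs s + \<epsilon>"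
proof -
  let ?S = "{strategy_value I vs s | s. feasible_strategy I vs s {..<length vs} (offline I)}"
  have "strategy_value I vs Stop \<in> ?S" by (intro CollectI exI[of _ Stop]) simp
  then have "?S \<noteq> {}" by blast
  with assms obtain x where "x \<in> ?S" "offline_opt I vs - \<epsilon> < x"
    using less_cSupE[of "offline_opt I vs - \<epsilon>" ?S] by (auto simp: offline_opt_def)
  then show ?thesis by force
qed

lemma set_pmf_arrival: "valid_osm I \<Longrightarrow> set_pmf (arrival I) = online I"
  by (auto simp: set_pmf_eq pmf_arrival) (auto simp: valid_osm_def)

lemma finite_set_arrivals:
  assumes "valid_osm I"
  shows "finite (set_pmf (replicate_pmf n (arrival I)))"
proof -
  have "finite {xs. set xs \<subseteq> online I \<and> length xs = n}"
    using assms by (intro finite_lists_length_eq) (auto simp: valid_osm_def)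
  then show ?thesis
    by (rule rev_finite_subset) (auto simp: set_replicate_pmf set_pmf_arrival[OF assms])
qed

theorem expected_opt_le_lp_value:
  assumes valid: "valid_osm I" and opt: "lp_optimal I f"
  shows "expected_opt I \<le> lp_value I f"
proof (rule field_le_epsilon)
  fix \<epsilon> :: real assume "0 < \<epsilon>"
  \<comment> \<open>One strategy per arrival sequence. Attainment of the supremum is not
    established, so each strategy is optimal only up to \<epsilon>.\<close>
  then have "\<exists>S. \<forall>vs. feasible_strategy I vs (S vs) {..<length vs} (offline I) \<and>
      offline_opt I vs \<le> strategy_value I vs (S vs) + \<epsilon>"
    using ex_near_optimal_strategy[OF valid] by (intro choice) blast
  then obtain S where feas: "feasible_strategy I vs (S vs) {..<length vs} (offline I)"
    and near: "offline_opt I vs \<le> strategy_value I vs (S vs) + \<epsilon>" for vs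
    by blast
  let ?P = "replicate_pmf (rounds I) (arrival I)"
  have [simp]: "integrable (measure_pmf ?P) h" for h :: "'b list \<Rightarrow> real"
    by (rule integrable_measure_pmf_finite[OF finite_set_arrivals[OF valid]])
  define g where "g e = measure_pmf.expectation ?P (\<lambda>vs. probe_mass I vs (S vs) e)" for e
  have "lp_feasible I g"
    unfolding lp_feasible_def
  proof (intro conjI ballI)
    fix u
    have "(\<Sum>e | e \<in> edges I \<and> fst e = u. g e * edge_prob I e) =
        measure_pmf.expectation ?P
          (\<lambda>vs. \<Sum>e | e \<in> edges I \<and> fst e = u. probe_mass I vs (S vs) e * edge_prob I e)"
      unfolding g_def by (subst Bochner_Integration.integral_sum) auto
    also have "\<dots> \<le> measure_pmf.expectation ?P (\<lambda>_. 1)"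
      by (intro integral_mono order_trans[OF probe_mass_offline_le[OF valid feas]]) auto
    finally show "(\<Sum>e | e \<in> edges I \<and> fst e = u. g e * edge_prob I e) \<le> 1" by simp
  next
    fix v assume v: "v \<in> online I"
    have "(\<Sum>e | e \<in> edges I \<and> snd e = v. g e) =
        measure_pmf.expectation ?P (\<lambda>vs. \<Sum>e | e \<in> edges I \<and> snd e = v. probe_mass I vs (S vs) e)"
      unfolding g_def by (subst Bochner_Integration.integral_sum) auto
    also have "\<dots> \<le> measure_pmf.expectation ?P (\<lambda>vs. real (length (filter (\<lambda>x. x = v) vs)))"
      using probe_mass_online_le[OF valid feas]
      by (intro integral_mono) (auto simp: length_filter_conv_card)
    also have "\<dots> = rate I v"
      using valid v by (simp add: expectation_count_replicate_pmf pmf_arrival valid_osm_def)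
    finally show "(\<Sum>e | e \<in> edges I \<and> snd e = v. g e) \<le> rate I v" .
  next
    show "0 \<le> g e" for e
      unfolding g_def by (intro Bochner_Integration.integral_nonneg probe_mass_nonneg[OF valid feas])
  qed
  have "expected_opt I \<le> measure_pmf.expectation ?P (\<lambda>vs. strategy_value I vs (S vs) + \<epsilon>)"
    unfolding expected_opt_def by (intro integral_mono near) auto
  also have "\<dots> = measure_pmf.expectation ?P (\<lambda>vs. strategy_value I vs (S vs)) + \<epsilon>"
    by simp
  also have "measure_pmf.expectation ?P (\<lambda>vs. strategy_value I vs (S vs)) = lp_value I g"
    unfolding strategy_value_eq_sum_probe_mass[OF valid feas] lp_value_def g_def
    by (subst Bochner_Integration.integral_sum) auto
  also have "lp_value I g \<le> lp_value I f"
    using opt \<open>lp_feasible I g\<close> by (simp add: lp_optimal_def)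
  finally show "expected_opt I \<le> lp_value I f + \<epsilon>" by simp
qed

section \<open>Non-adaptive policies\<close>

text \<open>Nesting \<open>map_pmf (Pair _)\<close> makes the probability of an event a product of
  three factors, via \<open>pmf_bind_map_Pair\<close>.\<close>

definition step :: "('u, 'v) osm \<Rightarrow> ('u, 'v) policy \<Rightarrow> ('u, 'v) event list \<Rightarrow> ('u, 'v) event pmf" where
  "step I \<pi> h = bind_pmf (arrival I) (\<lambda>v. map_pmf (Pair v)
     (bind_pmf (\<pi> h v) (\<lambda>c. map_pmf (Pair c) (probe I h v c))))"

lemma run_Suc_step:
  "run I \<pi> (Suc t) = bind_pmf (run I \<pi> t) (\<lambda>h. map_pmf (\<lambda>ev. h @ [ev]) (step I \<pi> h))"
  by (simp add: step_def map_pmf_def bind_assoc_pmf bind_return_pmf)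

lemma pmf_step: "pmf (step I \<pi> h) (v, c, b) = pmf (arrival I) v * (pmf (\<pi> h v) c * pmf (probe I h v c) b)"
  by (simp add: step_def pmf_bind_map_Pair)

lemma step_success:
  assumes "(v, c, True) \<in> set_pmf (step I \<pi> h)"
  obtains u where "c = Some u" "(u, v) \<in> edges I" "u \<notin> matched h"
  using assms by (auto simp: step_def probe_def split: option.splits if_splits)

lemma matched_snoc: "matched (h @ [(v, c, b)]) = matched h \<union> {u. c = Some u \<and> b}"
  by (auto simp: matched_def)

definition successes :: "('u, 'v) osm \<Rightarrow> ('u, 'v) event set" where
  "successes I = (\<lambda>(u, v). (v, Some u, True)) ` edges I"

lemma step_success_in_successes:
  "(v, c, True) \<in> set_pmf (step I \<pi> h) \<Longrightarrow> (v, c, True) \<in> successes I"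
  by (erule step_success) (force simp: successes_def)

text \<open>A policy may randomise over infinitely many selections, so a round can have infinite
  support. A functional that vanishes on failures lives on the finite set
  \<open>successes I\<close>, which gives integrability and a finite sum over the edges.\<close>

lemma expectation_step:
  fixes \<phi> :: "('u, 'v) event \<Rightarrow> real"
  assumes valid: "valid_osm I" and \<phi>: "\<And>v c. \<phi> (v, c, False) = 0"
  shows "integrable (measure_pmf (step I \<pi> h)) \<phi>"
    and "measure_pmf.expectation (step I \<pi> h) \<phi> =
      (\<Sum>(u, v)\<in>edges I. pmf (arrival I) v * pmf (\<pi> h v) (Some u) * edge_prob I (u, v) *
          of_bool (u \<notin> matched h) * \<phi> (v, Some u, True))"
proof -
  have fin: "finite (successes I)" using finite_edges[OF valid] by (simp add: successes_def)
  have supp: "ev \<in> successes I" if "ev \<in> set_pmf (step I \<pi> h)" "\<phi> ev \<noteq> 0" for ev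
  proof -
    obtain v c b where ev: "ev = (v, c, b)" by (cases ev)
    with that \<phi> have b by (cases b) auto
    with that ev show ?thesis using step_success_in_successes[of v c I \<pi> h] by simp
  qed
  show "integrable (measure_pmf (step I \<pi> h)) \<phi>"
  proof (rule integrable_measure_pmf_bounded_on)
    fix ev assume ev: "ev \<in> set_pmf (step I \<pi> h)"
    show "\<bar>\<phi> ev\<bar> \<le> (\<Sum>ev\<in>successes I. \<bar>\<phi> ev\<bar>)"
    proof (cases "\<phi> ev = 0")
      case False
      with supp[OF ev] fin show ?thesis by (intro member_le_sum) auto
    qed (auto intro: sum_nonneg)
  qed
  have "measure_pmf.expectation (step I \<pi> h) \<phi> = (\<Sum>ev\<in>successes I. \<phi> ev * pmf (step I \<pi> h) ev)"
    using fin supp by (intro integral_measure_pmf_real) auto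
  also have "\<dots> = (\<Sum>(u, v)\<in>edges I. \<phi> (v, Some u, True) * pmf (step I \<pi> h) (v, Some u, True))"
    unfolding successes_def by (subst sum.reindex) (auto simp: inj_on_def intro!: sum.cong)
  also have "\<dots> = (\<Sum>(u, v)\<in>edges I. pmf (arrival I) v * pmf (\<pi> h v) (Some u) * edge_prob I (u, v) *
          of_bool (u \<notin> matched h) * \<phi> (v, Some u, True))"
    using valid
    by (intro sum.cong) (auto simp: pmf_step probe_def valid_osm_def less_imp_le split: prod.splits)
  finally show "measure_pmf.expectation (step I \<pi> h) \<phi> = \<dots>" .
qed

section \<open>Rewards along a run: bounds and integrability\<close>

lemma reward_snoc: "reward I (h @ [(v, c, b)]) = reward I h + (if b then weight I (the c, v) else 0)"
  by (simp add: reward_def)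

lemma length_run: "h \<in> set_pmf (run I \<pi> t) \<Longrightarrow> length h = t"
  by (induction t arbitrary: h) auto

text \<open>Weights are unconstrained outside \<open>edges I\<close>, but a rewarded event on a
  reachable history comes from an edge, so a round adds at most the total weight.\<close>

lemma reward_run_bounds:
  assumes "valid_osm I" "h \<in> set_pmf (run I \<pi> t)"
  shows "0 \<le> reward I h" "reward I h \<le> real t * (\<Sum>e\<in>edges I. weight I e)"
proof -
  have "0 \<le> reward I h \<and> reward I h \<le> real t * (\<Sum>e\<in>edges I. weight I e)"
    using assms(2)
  proof (induction t arbitrary: h)
    case 0
    then show ?case by (simp add: reward_def)
  next
    case (Suc t)
    from Suc.prems obtain h' v c b where h: "h' \<in> set_pmf (run I \<pi> t)" "h = h' @ [(v, c, b)]"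
      and ev: "(v, c, b) \<in> set_pmf (step I \<pi> h')"
      unfolding run_Suc_step by auto
    have w: "0 \<le> weight I e" if "e \<in> edges I" for e
      using that assms(1) by (auto simp: valid_osm_def)
    have "weight I (the c, v) \<le> (\<Sum>e\<in>edges I. weight I e) \<and> 0 \<le> weight I (the c, v)" if b
    proof -
      from ev that obtain u where "c = Some u" "(u, v) \<in> edges I"
        by (auto elim: step_success)
      then show ?thesis
        using w finite_edges[OF assms(1)] by (auto intro: member_le_sum)
    qed
    moreover have "0 \<le> (\<Sum>e\<in>edges I. weight I e)" using w by (rule sum_nonneg)
    ultimately show ?case using Suc.IH[OF h(1)] by (auto simp: h(2) reward_snoc algebra_simps)
  qed
  then show "0 \<le> reward I h" "reward I h \<le> real t * (\<Sum>e\<in>edges I. weight I e)" by auto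
qed

lemma integrable_reward_run: "valid_osm I \<Longrightarrow> integrable (measure_pmf (run I \<pi> t)) (reward I)"
  by (rule integrable_measure_pmf_bounded_on[where B = "real t * (\<Sum>e\<in>edges I. weight I e)"])
     (use reward_run_bounds in fastforce)

lemma integrable_unmatched: "integrable (measure_pmf p) (\<lambda>h :: ('u, 'v) event list. of_bool (u \<notin> matched h) :: real)"
  by (rule integrable_measure_pmf_bounded_on[where B = 1]) auto

text \<open>A non-adaptive policy is given by the selections \<open>\<sigma> t v\<close> made for \<open>v\<close> in round \<open>t\<close>.\<close>
abbreviation (input) na_run ::
  "('u, 'v) osm \<Rightarrow> (nat \<Rightarrow> 'v \<Rightarrow> 'u option pmf) \<Rightarrow> nat \<Rightarrow> ('u, 'v) event list pmf" where
  "na_run I \<sigma> \<equiv> run I (\<lambda>h. \<sigma> (length h))"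

text \<open>The conditional probability that \<open>e\<close> is matched in round \<open>t\<close>,
  given that its offline endpoint is free. No history enters: this is where non-adaptivity is
  exploited.\<close>

definition hit ::
  "('u, 'v) osm \<Rightarrow> (nat \<Rightarrow> 'v \<Rightarrow> 'u option pmf) \<Rightarrow> nat \<Rightarrow> 'u \<times> 'v \<Rightarrow> real" where
  "hit I \<sigma> t e = pmf (arrival I) (snd e) * pmf (\<sigma> t (snd e)) (Some (fst e)) * edge_prob I e"

definition unmatched_prob ::
  "('u, 'v) osm \<Rightarrow> (nat \<Rightarrow> 'v \<Rightarrow> 'u option pmf) \<Rightarrow> nat \<Rightarrow> 'u \<Rightarrow> real" where
  "unmatched_prob I \<sigma> t u =
     measure_pmf.expectation (na_run I \<sigma> t) (\<lambda>h. of_bool (u \<notin> matched h))"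

text \<open>Common one-round recursion for the unmatched indicator and the reward:
  \<open>\<phi>\<close> is the increment of \<open>F\<close>, and given the history its expectation
  is a sum over the edges with free offline endpoint.\<close>

lemma expectation_run_Suc:
  fixes I :: "('u, 'v) osm" and F :: "('u, 'v) event list \<Rightarrow> real"
  assumes valid: "valid_osm I" and \<phi>: "\<And>h v c. \<phi> h (v, c, False) = 0"
    and F: "\<And>h ev. h \<in> set_pmf (na_run I \<sigma> t) \<Longrightarrow> ev \<in> set_pmf (step I (\<lambda>h. \<sigma> (length h)) h) \<Longrightarrow>
              F (h @ [ev]) = F h + \<phi> h ev"
    and nonneg: "\<And>h. h \<in> set_pmf (na_run I \<sigma> (Suc t)) \<Longrightarrow> 0 \<le> F h"
    and bound: "\<And>h. h \<in> set_pmf (na_run I \<sigma> (Suc t)) \<Longrightarrow> F h \<le> B"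
  shows "measure_pmf.expectation (na_run I \<sigma> (Suc t)) F =
    measure_pmf.expectation (na_run I \<sigma> t) (\<lambda>h. F h +
      (\<Sum>e\<in>edges I. hit I \<sigma> t e * of_bool (fst e \<notin> matched h) * \<phi> h (snd e, Some (fst e), True)))"
proof -
  let ?S = "step I (\<lambda>h. \<sigma> (length h))"
  have "measure_pmf.expectation (na_run I \<sigma> (Suc t)) F =
      measure_pmf.expectation (na_run I \<sigma> t) (\<lambda>h. measure_pmf.expectation (map_pmf (\<lambda>ev. h @ [ev]) (?S h)) F)"
    unfolding run_Suc_step
    by (rule expectation_bind_pmf_bounded[where B = B])
       (use nonneg bound in \<open>auto simp: run_Suc_step simp del: run.simps\<close>)
  also have "\<dots> = measure_pmf.expectation (na_run I \<sigma> t) (\<lambda>h. F h +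
      (\<Sum>e\<in>edges I. hit I \<sigma> t e * of_bool (fst e \<notin> matched h) * \<phi> h (snd e, Some (fst e), True)))"
  proof (rule integral_cong_AE)
    show "AE h in na_run I \<sigma> t. measure_pmf.expectation (map_pmf (\<lambda>ev. h @ [ev]) (?S h)) F =
      F h + (\<Sum>e\<in>edges I. hit I \<sigma> t e * of_bool (fst e \<notin> matched h) * \<phi> h (snd e, Some (fst e), True))"
      unfolding AE_measure_pmf_iff
    proof
      fix h assume h: "h \<in> set_pmf (na_run I \<sigma> t)"
      have "measure_pmf.expectation (map_pmf (\<lambda>ev. h @ [ev]) (?S h)) F =
          measure_pmf.expectation (?S h) (\<lambda>ev. F h + \<phi> h ev)"
        unfolding integral_map_pmf
        by (rule integral_cong_AE) (use F[OF h] in \<open>auto simp: AE_measure_pmf_iff\<close>)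
      also have "\<dots> = F h + measure_pmf.expectation (?S h) (\<phi> h)"
        using expectation_step(1)[of I "\<phi> h", OF valid \<phi>] by simp
      also have "measure_pmf.expectation (?S h) (\<phi> h) =
          (\<Sum>e\<in>edges I. hit I \<sigma> t e * of_bool (fst e \<notin> matched h) * \<phi> h (snd e, Some (fst e), True))"
        unfolding expectation_step(2)[of I "\<phi> h", OF valid \<phi>] using length_run[OF h]
        by (intro sum.cong) (auto simp: hit_def)
      finally show "measure_pmf.expectation (map_pmf (\<lambda>ev. h @ [ev]) (?S h)) F = F h + \<dots>" .
    qed
  qed auto
  finally show ?thesis .
qed

text \<open>For a free \<open>u\<close> the chance of being matched is the same after every history,
  so it factors out of the expectation although the histories of different offline vertices are
  correlated.\<close>

lemma unmatched_prob_Suc: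
  fixes I :: "('u, 'v) osm"
  assumes valid: "valid_osm I"
  shows "unmatched_prob I \<sigma> (Suc t) u = unmatched_prob I \<sigma> t u * (1 - (\<Sum>e | e \<in> edges I \<and> fst e = u. hit I \<sigma> t e))"
proof -
  \<comment> \<open>The indicator of \<open>u\<close> being unmatched drops by one exactly when a
    free \<open>u\<close> is matched.\<close>
  let ?\<phi> = "\<lambda>h (v, c, b). - of_bool (u \<notin> matched h \<and> c = Some u \<and> b) :: real"
  have "unmatched_prob I \<sigma> (Suc t) u = measure_pmf.expectation (na_run I \<sigma> t) (\<lambda>h. of_bool (u \<notin> matched h) +
     (\<Sum>e\<in>edges I. hit I \<sigma> t e * of_bool (fst e \<notin> matched h) * ?\<phi> h (snd e, Some (fst e), True)))"
    unfolding unmatched_prob_def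
    by (rule expectation_run_Suc[OF valid, where B = 1]) (auto simp: matched_snoc)
  also have "\<dots> = measure_pmf.expectation (na_run I \<sigma> t)
      (\<lambda>h. of_bool (u \<notin> matched h) * (1 - (\<Sum>e | e \<in> edges I \<and> fst e = u. hit I \<sigma> t e)))"
  proof (rule Bochner_Integration.integral_cong[OF refl])
    fix h :: "('u, 'v) event list"
    have "(\<Sum>e\<in>edges I. hit I \<sigma> t e * of_bool (fst e \<notin> matched h) * ?\<phi> h (snd e, Some (fst e), True)) =
       (\<Sum>e\<in>edges I. if fst e = u then - of_bool (u \<notin> matched h) * hit I \<sigma> t e else 0)"
      by (rule sum.cong) auto
    also have "\<dots> = - of_bool (u \<notin> matched h) * (\<Sum>e | e \<in> edges I \<and> fst e = u. hit I \<sigma> t e)"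
      using finite_edges[OF valid] by (simp add: sum.If_cases Int_def sum_negf)
    finally show "of_bool (u \<notin> matched h) +
       (\<Sum>e\<in>edges I. hit I \<sigma> t e * of_bool (fst e \<notin> matched h) * ?\<phi> h (snd e, Some (fst e), True)) =
       of_bool (u \<notin> matched h) * (1 - (\<Sum>e | e \<in> edges I \<and> fst e = u. hit I \<sigma> t e))"
      by (simp add: algebra_simps)
  qed
  also have "\<dots> = unmatched_prob I \<sigma> t u * (1 - (\<Sum>e | e \<in> edges I \<and> fst e = u. hit I \<sigma> t e))"
    unfolding unmatched_prob_def by simp
  finally show ?thesis .
qed

lemma unmatched_prob_eq_prod:
  assumes valid: "valid_osm I"
  shows "unmatched_prob I \<sigma> t u = (\<Prod>s<t. 1 - (\<Sum>e | e \<in> edges I \<and> fst e = u. hit I \<sigma> s e))"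
  by (induction t) (simp_all add: unmatched_prob_Suc[OF valid], simp add: unmatched_prob_def matched_def)

lemma expectation_reward_Suc:
  assumes valid: "valid_osm I"
  shows "measure_pmf.expectation (na_run I \<sigma> (Suc t)) (reward I) =
     measure_pmf.expectation (na_run I \<sigma> t) (reward I) +
     (\<Sum>e\<in>edges I. hit I \<sigma> t e * weight I e * unmatched_prob I \<sigma> t (fst e))"
proof -
  let ?\<phi> = "\<lambda>(v, c, b). if b then weight I (the c, v) else 0"
  have "measure_pmf.expectation (na_run I \<sigma> (Suc t)) (reward I) =
    measure_pmf.expectation (na_run I \<sigma> t) (\<lambda>h. reward I h +
      (\<Sum>e\<in>edges I. hit I \<sigma> t e * of_bool (fst e \<notin> matched h) * ?\<phi> (snd e, Some (fst e), True)))"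
    by (rule expectation_run_Suc[OF valid, where B = "real (Suc t) * (\<Sum>e\<in>edges I. weight I e)"])
       (use reward_run_bounds[OF valid] in \<open>auto simp: reward_snoc simp del: run.simps of_nat_Suc\<close>)
  also have "\<dots> = measure_pmf.expectation (na_run I \<sigma> t) (\<lambda>h. reward I h +
      (\<Sum>e\<in>edges I. hit I \<sigma> t e * weight I e * of_bool (fst e \<notin> matched h)))"
    by (intro Bochner_Integration.integral_cong refl arg_cong2[where f = "(+)"] sum.cong) auto
  also have "\<dots> = measure_pmf.expectation (na_run I \<sigma> t) (reward I) +
      (\<Sum>e\<in>edges I. hit I \<sigma> t e * weight I e * unmatched_prob I \<sigma> t (fst e))"
    unfolding unmatched_prob_def
    by (subst Bochner_Integration.integral_add)
       (auto simp: integrable_reward_run[OF valid] integrable_unmatched Bochner_Integration.integral_sum)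
  finally show ?thesis .
qed

lemma expectation_reward_eq_sum:
  assumes valid: "valid_osm I"
  shows "measure_pmf.expectation (na_run I \<sigma> t) (reward I) =
     (\<Sum>s<t. \<Sum>e\<in>edges I. hit I \<sigma> s e * weight I e * unmatched_prob I \<sigma> s (fst e))"
  by (induction t) (simp add: reward_def, simp add: expectation_reward_Suc[OF valid] del: run.simps)

section \<open>The competitive ratio of SM\<close>

lemma one_minus_inverse_exp_le:
  assumes "0 < n"
  shows "1 - 1 / exp 1 \<le> 1 - (1 - 1 / real n) ^ n"
  using exp_ge_one_minus_x_over_n_power_n[of 1 n] assms by (simp add: exp_minus inverse_eq_divide)

theorem SM_ge_lp_value:
  assumes valid: "valid_osm I" and feas: "lp_feasible I f"
  shows "(1 - 1 / exp 1) * lp_value I f \<le> expected_alg I (SM I f)"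
proof -
  define n where "n = rounds I"
  have n: "0 < n" using valid by (simp add: n_def valid_osm_def)
  define \<sigma> where "\<sigma> = (\<lambda>t::nat. SM_choice I f)"
  have edge: "snd e \<in> online I \<and> fst e \<in> offline I \<and> 0 < rate I (snd e) \<and> 0 \<le> f e \<and> 0 \<le> weight I e \<and>
      0 < edge_prob I e" if "e \<in> edges I" for e
    using that valid feas by (cases e) (auto simp: valid_osm_def lp_feasible_def)
  \<comment> \<open>The rate cancels between the arrival probability \<open>rate I v / n\<close> and
    the selection probability \<open>f e / rate I v\<close>.\<close>
  have hit: "hit I \<sigma> t e = f e * edge_prob I e / n" if "e \<in> edges I" for t e
    using edge[OF that] that pmf_SM_choice[OF valid feas, of "snd e" "Some (fst e)"]
    by (simp add: hit_def \<sigma>_def pmf_arrival[OF valid] n_def)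
  have unmatched: "(1 - 1 / n) ^ t \<le> unmatched_prob I \<sigma> t u" if u: "u \<in> offline I" for t u
  proof -
    let ?x = "\<Sum>e | e \<in> edges I \<and> fst e = u. f e * edge_prob I e"
    have "(\<Sum>e | e \<in> edges I \<and> fst e = u. hit I \<sigma> s e) = ?x / n" for s
      by (simp add: hit sum_divide_distrib)
    then have "unmatched_prob I \<sigma> t u = (1 - ?x / n) ^ t"
      by (simp add: unmatched_prob_eq_prod[OF valid])
    moreover have "?x \<le> 1" using feas u by (simp add: lp_feasible_def)
    ultimately show ?thesis using n by (auto intro!: power_mono simp: divide_right_mono)
  qed
  have gp: "(\<Sum>s<n. (1 - 1 / real n) ^ s) / n = 1 - (1 - 1 / real n) ^ n"
    by (simp add: one_diff_power_eq)
  have "(1 - 1 / exp 1) * lp_value I f \<le> (1 - (1 - 1 / real n) ^ n) * lp_value I f"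
    using one_minus_inverse_exp_le[OF n] edge
    by (intro mult_right_mono) (auto simp: lp_value_def less_imp_le intro!: sum_nonneg)
  \<comment> \<open>Writing the factor as a geometric sum distributes it over the rounds, so that
    the comparison becomes termwise in \<open>s\<close> and \<open>e\<close>.\<close>
  also have "\<dots> = (\<Sum>s<n. \<Sum>e\<in>edges I. f e * edge_prob I e / n * weight I e * (1 - 1 / n) ^ s)"
    unfolding lp_value_def gp[symmetric]
    by (simp add: sum_distrib_left sum_distrib_right sum_divide_distrib mult_ac)
  also have "\<dots> \<le> (\<Sum>s<n. \<Sum>e\<in>edges I. hit I \<sigma> s e * weight I e * unmatched_prob I \<sigma> s (fst e))"
  proof (intro sum_mono)
    fix s e assume "e \<in> edges I"
    then show "f e * edge_prob I e / n * weight I e * (1 - 1 / n) ^ s \<le>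
        hit I \<sigma> s e * weight I e * unmatched_prob I \<sigma> s (fst e)"
      unfolding hit[OF \<open>e \<in> edges I\<close>] using edge[of e]
      by (intro mult_left_mono unmatched) (auto simp: less_imp_le)
  qed
  also have "\<dots> = expected_alg I (SM I f)"
    by (simp add: expectation_reward_eq_sum[OF valid, symmetric] expected_alg_def SM_def
        bind_return_pmf n_def \<sigma>_def)
  finally show ?thesis .
qed

lemma nonadaptive_SM: "nonadaptive (SM I f)"
  by (simp add: nonadaptive_def SM_def)

theorem SM_achieves_ratio:
  assumes "\<And>I. valid_osm I \<Longrightarrow> lp_optimal I (F I)"
  shows "achieves_ratio (\<lambda>I. SM I (F I)) (1 - 1 / exp 1)"
  unfolding achieves_ratio_def
\<comment> \<open>The guarantee holds for every number of rounds, hence the threshold 0; the loss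
  \<epsilon> is harmless because the optimum is nonnegative.\<close>
proof (intro allI impI exI[of _ 0])
  fix \<epsilon> :: real and I :: "('a, 'b) osm"
  assume \<epsilon>: "0 < \<epsilon>" and "valid_osm I \<and> 0 \<le> rounds I"
  then have valid: "valid_osm I" by simp
  have "0 \<le> expected_opt I"
    unfolding expected_opt_def
    by (intro Bochner_Integration.integral_nonneg offline_opt_nonneg[OF valid])
  then have "(1 - 1 / exp 1 - \<epsilon>) * expected_opt I \<le> (1 - 1 / exp 1) * expected_opt I"
    using \<epsilon> by (intro mult_right_mono) auto
  also have "\<dots> \<le> (1 - 1 / exp 1) * lp_value I (F I)"
    using expected_opt_le_lp_value[OF valid assms[OF valid]] by (intro mult_left_mono) auto
  also have "\<dots> \<le> expected_alg I (SM I (F I))"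
    using assms[OF valid] by (intro SM_ge_lp_value[OF valid]) (simp add: lp_optimal_def)
  finally show "(1 - 1 / exp 1 - \<epsilon>) * expected_opt I \<le> expected_alg I (SM I (F I))" .
qed

section \<open>Optimality among non-adaptive algorithms\<close>

definition star_osm :: "'u set \<Rightarrow> 'v \<Rightarrow> ('u, 'v) osm" where
  "star_osm U v =
     \<lparr>offline = U, online = {v}, edges = U \<times> {v}, rate = (\<lambda>_. real ((card U)\<^sup>2)), weight = (\<lambda>_. 1),
      edge_prob = (\<lambda>_. 1 / real (card U)), rounds = (card U)\<^sup>2\<rparr>"

lemma star_osm_simps [simp]:
  "offline (star_osm U v) = U" "online (star_osm U v) = {v}" "edges (star_osm U v) = U \<times> {v}"
  "rate (star_osm U v) x = real ((card U)\<^sup>2)" "weight (star_osm U v) e = 1"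
  "edge_prob (star_osm U v) e = 1 / real (card U)" "rounds (star_osm U v) = (card U)\<^sup>2"
  by (simp_all add: star_osm_def)

lemma valid_star_osm:
  assumes "finite U" "U \<noteq> {}"
  shows "valid_osm (star_osm U v)"
proof -
  have "0 < card U" using assms by (simp add: card_gt_0_iff)
  then show ?thesis using assms by (auto simp: valid_osm_def)
qed

lemma arrival_star_osm:
  assumes "finite U" "U \<noteq> {}"
  shows "arrival (star_osm U v) = return_pmf v"
  using set_pmf_arrival[OF valid_star_osm[OF assms, of v]] by (simp flip: set_pmf_subset_singleton)

text \<open>The arguments are the number of probes left, the index of the next arrival and the
  vertices still unmatched.\<close>

fun greedy :: "nat \<Rightarrow> nat \<Rightarrow> 'u list \<Rightarrow> 'u strategy" where
  "greedy 0 i us = Stop"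
| "greedy (Suc k) i [] = Stop"
| "greedy (Suc k) i (u # us) = Probe i u (greedy k (Suc i) us) (greedy k (Suc i) (u # us))"

lemma feasible_greedy:
  assumes "distinct us" "set us \<subseteq> A" "{i..<i + k} \<subseteq> R" "length vs \<ge> i + k"
    and "\<And>j u. u \<in> set us \<Longrightarrow> j < length vs \<Longrightarrow> (u, vs ! j) \<in> edges I"
  shows "feasible_strategy I vs (greedy k i us) R A"
  using assms
proof (induction k i us arbitrary: R A rule: greedy.induct)
  case (3 k i u us)
  have "feasible_strategy I vs (greedy k (Suc i) us) (R - {i}) (A - {u})"
    by (rule "3.IH"(1)) (use "3.prems" in auto)
  moreover have "feasible_strategy I vs (greedy k (Suc i) (u # us)) (R - {i}) A"
    by (rule "3.IH"(2)) (use "3.prems" in auto)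
  ultimately show ?case using "3.prems" by auto
qed auto

text \<open>
  With \<open>X\<close> binomially distributed for \<open>k\<close> trials of probability \<open>p\<close>, the greedy value is the
  expectation of \<open>min X j\<close>, and \<open>min x j \<ge> x - (x - j + a)\<^sup>2 / (4 * a)\<close>; the bound is the
  expectation of the latter.
\<close>
lemma greedy_value_ge:
  assumes p: "0 \<le> p" "p \<le> 1" and a: "0 < a"
    and inst: "\<And>e. edge_prob I e = p" "\<And>e. weight I e = 1"
  shows "real k * p - ((real k * p - real (length us) + a)\<^sup>2 + real k * p * (1 - p)) / (4 * a) \<le>
           strategy_value I vs (greedy k i us)"
proof (induction k i us rule: greedy.induct)
  case (1 i us)
  show ?case using a by simp
next
  case (2 k i)
  let ?x = "real (Suc k) * p"
  have "?x * (4 * a) \<le> (?x + a)\<^sup>2"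
    using zero_le_power2[of "?x - a"] by (simp add: power2_eq_square algebra_simps)
  \<comment> \<open>No vertex is left and the strategy earns 0.\<close>
  also have "\<dots> \<le> (?x + a)\<^sup>2 + ?x * (1 - p)" using p by simp
  finally show ?case using a by (simp add: pos_le_divide_eq)
next
  case (3 k i u us)
  let ?L = "\<lambda>k j. k * p - ((k * p - j + a)\<^sup>2 + k * p * (1 - p)) / (4 * a)"
  let ?k = "real k" and ?j = "real (length us)"
  \<comment> \<open>Conditioning on the first trial: a success contributes 1 and lowers both the
    number of trials and the capacity, a failure only the former. The quadratic bound obeys this
    recursion exactly.\<close>
  have "?L (?k + 1) (?j + 1) = p * (1 + ?L ?k ?j) + (1 - p) * ?L ?k (?j + 1)"
    unfolding divide_inverse by algebra
  also have "\<dots> \<le> p * (1 + strategy_value I vs (greedy k (Suc i) us)) +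
      (1 - p) * strategy_value I vs (greedy k (Suc i) (u # us))"
    using "3.IH" p by (intro add_mono mult_left_mono) (auto simp: add.commute)
  finally show ?case by (simp add: inst add.commute)
qed

text \<open>The mean number of successes equals the number \<open>m\<close> of offline vertices, so
  \<open>greedy_value_ge\<close> loses only \<open>(a\<^sup>2 + m - 1) / (4 * a)\<close>. Taking
  \<open>a = sqrt m\<close> balances \<open>a\<^sup>2\<close> against the variance
  \<open>m - 1\<close>.\<close>

lemma expected_opt_star_osm_ge:
  assumes "finite U" "U \<noteq> {}"
  shows "real (card U) - sqrt (real (card U)) / 2 \<le> expected_opt (star_osm U v)"
proof -
  let ?m = "real (card U)" and ?n = "(card U)\<^sup>2" and ?I = "star_osm U v"
  let ?vs = "replicate ?n v"
  have m: "0 < ?m" using assms by (simp add: card_gt_0_iff)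
  obtain us where us: "set us = U" "distinct us" using finite_distinct_list[OF assms(1)] by blast
  then have len: "length us = card U" using distinct_card by fastforce
  have rep: "replicate_pmf n (return_pmf v) = return_pmf (replicate n v)" for n
    by (induction n) (simp_all add: bind_return_pmf)
  have "?m - sqrt ?m / 2 \<le> ?m - ((sqrt ?m)\<^sup>2 + ?m * (1 - 1 / ?m)) / (4 * sqrt ?m)"
  proof -
    have "((sqrt ?m)\<^sup>2 + ?m * (1 - 1 / ?m)) \<le> 2 * (sqrt ?m)\<^sup>2"
      using m by (simp add: field_simps)
    then have "((sqrt ?m)\<^sup>2 + ?m * (1 - 1 / ?m)) / (4 * sqrt ?m) \<le> 2 * (sqrt ?m)\<^sup>2 / (4 * sqrt ?m)"
      using m by (intro divide_right_mono) auto
    also have "\<dots> = sqrt ?m / 2" by (simp add: real_div_sqrt)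
    finally show ?thesis by simp
  qed
  also have "\<dots> \<le> strategy_value ?I ?vs (greedy ?n 0 us)"
    using greedy_value_ge[of "1 / ?m" "sqrt ?m" ?I ?n us ?vs 0] m
    by (simp add: len power2_eq_square)
  also have "\<dots> \<le> offline_opt ?I ?vs"
    by (intro strategy_value_le_offline_opt valid_star_osm assms feasible_greedy) (use us in auto)
  also have "\<dots> = expected_opt ?I"
    by (simp add: expected_opt_def arrival_star_osm[OF assms] rep)
  finally show ?thesis .
qed

section \<open>Convexity and the upper bound for non-adaptive algorithms on the star\<close>

lemma powr_le_chord:
  fixes b s :: real
  assumes "0 < b" "0 \<le> s" "s \<le> 1"
  shows "b powr s \<le> 1 - (1 - b) * s"
proof -
  \<comment> \<open>Convexity of \<open>exp\<close> between 0 and \<open>ln b\<close>; the chord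
    joins the values 1 at \<open>s = 0\<close> and \<open>b\<close> at \<open>s = 1\<close>.\<close>
  have "exp ((1 - s) *\<^sub>R 0 + s *\<^sub>R ln b) \<le> (1 - s) * exp 0 + s * exp (ln b)"
    using assms by (intro convex_onD[OF exp_convex]) auto
  then show ?thesis using assms by (simp add: powr_def algebra_simps)
qed

text \<open>
  Each product is at least \<open>b powr k u\<close>, where \<open>k u\<close> is the expected number of selections of \<open>u\<close>;
  summing the tangent lines of \<open>\<lambda>x. b powr x\<close> at \<open>card U\<close>, the average of the \<open>k u\<close> being at most
  \<open>card U\<close>, gives the bound.
\<close>
lemma sum_prod_ge_of_sum_le:
  fixes s :: "nat \<Rightarrow> 'u \<Rightarrow> real"
  assumes U: "finite U" "U \<noteq> {}" and b: "0 < b" "b \<le> 1"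
    and s: "\<And>t u. 0 \<le> s t u" "\<And>t u. s t u \<le> 1" "\<And>t. (\<Sum>u\<in>U. s t u) \<le> 1"
  shows "real (card U) * b ^ card U \<le> (\<Sum>u\<in>U. \<Prod>t<(card U)\<^sup>2. 1 - (1 - b) * s t u)"
proof -
  let ?m = "real (card U)" and ?n = "(card U)\<^sup>2"
  define k where "k u = (\<Sum>t<?n. s t u)" for u
  have "(\<Sum>u\<in>U. k u) = (\<Sum>t<?n. \<Sum>u\<in>U. s t u)"
    unfolding k_def by (rule sum.swap)
  also have "\<dots> \<le> (\<Sum>t<?n. 1)" by (intro sum_mono s)
  finally have k: "(\<Sum>u\<in>U. k u - ?m) \<le> 0" by (simp add: sum_subtractf power2_eq_square)
  have lnb: "ln b \<le> 0" using b by simp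
  \<comment> \<open>The added term is nonnegative: both \<open>ln b\<close> and the sum are at most
    0.\<close>
  have "?m * b ^ card U \<le> ?m * b ^ card U + b ^ card U * ln b * (\<Sum>u\<in>U. k u - ?m)"
    using b k lnb by (simp add: mult_nonpos_nonpos mult_nonneg_nonpos)
  also have "\<dots> = (\<Sum>u\<in>U. b ^ card U * (1 + ln b * (k u - ?m)))"
    by (simp add: sum.distrib distrib_left mult.assoc flip: sum_distrib_left)
  also have "\<dots> \<le> (\<Sum>u\<in>U. b ^ card U * exp (ln b * (k u - ?m)))"
    using b by (intro sum_mono mult_left_mono exp_ge_add_one_self) auto
  also have "\<dots> = (\<Sum>u\<in>U. b powr k u)"
  proof (rule sum.cong[OF refl])
    fix u
    have "b ^ card U = b powr ?m" using b by (simp add: powr_realpow)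
    then show "b ^ card U * exp (ln b * (k u - ?m)) = b powr k u"
      using b by (simp add: powr_def algebra_simps flip: exp_add)
  qed
  also have "\<dots> = (\<Sum>u\<in>U. \<Prod>t<?n. b powr s t u)"
    unfolding k_def using b by (intro sum.cong) (simp_all add: powr_sum)
  also have "\<dots> \<le> (\<Sum>u\<in>U. \<Prod>t<?n. 1 - (1 - b) * s t u)"
    using b s by (intro sum_mono prod_mono conjI powr_le_chord) auto
  finally show ?thesis .
qed

text \<open>With unit weights, the expected reward of a round is the drop in the expected number of
  unmatched vertices. Telescoping leaves \<open>m\<close> minus the final unmatched probabilities,
  whose sum \<open>sum_prod_ge_of_sum_le\<close> bounds from below.\<close>

lemma nonadaptive_policy_star_osm_le:
  assumes U: "finite U" "2 \<le> card U"
  shows "measure_pmf.expectation (run (star_osm U v) (\<lambda>h. \<sigma> (length h)) ((card U)\<^sup>2)) (reward (star_osm U v))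
     \<le> real (card U) * (1 - (1 - 1 / real (card U)) ^ card U)"
proof -
  let ?I = "star_osm U v" and ?m = "real (card U)" and ?n = "(card U)\<^sup>2"
  have ne: "U \<noteq> {}" using U by auto
  note valid = valid_star_osm[OF U(1) ne, of v]
  define s where "s t u = pmf (\<sigma> t v) (Some u)" for t u
  define q where "q = unmatched_prob ?I \<sigma>"
  have hit: "hit ?I \<sigma> t (u, v) = s t u / ?m" for t u
    by (simp add: hit_def arrival_star_osm[OF U(1) ne] s_def)
  have hit_sum: "(\<Sum>e | e \<in> U \<times> {v} \<and> fst e = u. hit ?I \<sigma> t e) = s t u / ?m" if "u \<in> U" for t u
  proof -
    have "{e. e \<in> U \<times> {v} \<and> fst e = u} = {(u, v)}" using that by auto
    then show ?thesis by (simp add: hit)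
  qed
  have q_Suc: "q (Suc t) u = q t u * (1 - s t u / ?m)" if "u \<in> U" for t u
    using unmatched_prob_Suc[OF valid, of \<sigma> t u] hit_sum[OF that] by (simp add: q_def)
  have q_prod: "q t u = (\<Prod>t<t. 1 - s t u / ?m)" if "u \<in> U" for t u
    using unmatched_prob_eq_prod[OF valid, of \<sigma> t u] hit_sum[OF that] by (simp add: q_def)
  have s_sum: "(\<Sum>u\<in>U. s t u) \<le> 1" for t
  proof -
    have "(\<Sum>u\<in>U. s t u) = measure_pmf.prob (\<sigma> t v) (Some ` U)"
      using U by (simp add: s_def measure_measure_pmf_finite sum.reindex)
    then show ?thesis by simp
  qed
  have "measure_pmf.expectation (run ?I (\<lambda>h. \<sigma> (length h)) ?n) (reward ?I) =
      (\<Sum>t<?n. \<Sum>e\<in>U \<times> {v}. hit ?I \<sigma> t e * q t (fst e))"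
    using expectation_reward_eq_sum[OF valid, of \<sigma> ?n] by (simp add: q_def)
  also have "\<dots> = (\<Sum>t<?n. \<Sum>u\<in>U. q t u - q (Suc t) u)"
  proof (rule sum.cong[OF refl])
    fix t
    have "(\<Sum>e\<in>U \<times> {v}. hit ?I \<sigma> t e * q t (fst e)) = (\<Sum>u\<in>U. hit ?I \<sigma> t (u, v) * q t u)"
      by (rule sum.reindex_bij_witness[of _ "\<lambda>u. (u, v)" fst]) auto
    also have "\<dots> = (\<Sum>u\<in>U. q t u - q (Suc t) u)"
      by (intro sum.cong) (simp_all add: q_Suc hit algebra_simps)
    finally show "(\<Sum>e\<in>U \<times> {v}. hit ?I \<sigma> t e * q t (fst e)) = \<dots>" .
  qed
  also have "\<dots> = (\<Sum>u\<in>U. q 0 u - q ?n u)"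
    by (subst sum.swap) (rule sum.cong[OF refl sum_lessThan_telescope'])
  \<comment> \<open>The factor \<open>1 / m\<close> is written as \<open>1 - b\<close> with
    \<open>b = 1 - 1 / m\<close>, which is positive because \<open>2 \<le> card U\<close>.\<close>
  also have "\<dots> = ?m - (\<Sum>u\<in>U. \<Prod>t<?n. 1 - (1 - (1 - 1 / ?m)) * s t u)"
    by (simp add: q_prod sum_subtractf)
  also have "\<dots> \<le> ?m - ?m * (1 - 1 / ?m) ^ card U"
    using U ne s_sum
    by (intro diff_left_mono sum_prod_ge_of_sum_le) (auto simp: s_def pmf_le_1 divide_simps)
  finally show ?thesis by (simp add: algebra_simps)
qed

lemma nonadaptive_star_osm_le:
  assumes U: "finite U" "2 \<le> card U" and na: "nonadaptive A"
  shows "expected_alg (star_osm U v) A \<le> real (card U) * (1 - (1 - 1 / real (card U)) ^ card U)"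
    (is "_ \<le> ?b")
proof -
  let ?I = "star_osm U v"
  have valid: "valid_osm ?I" using U by (intro valid_star_osm) auto
  have le: "measure_pmf.expectation (run ?I \<pi> (rounds ?I)) (reward ?I) \<le> ?b" if "\<pi> \<in> set_pmf A" for \<pi>
  proof -
    \<comment> \<open>Only the length of a history matters, so a dummy history of that length
      represents it, and \<open>\<pi>\<close> takes the form
      \<open>\<sigma> (length h)\<close>.\<close>
    have "\<pi> h w = \<pi> (replicate (length h) undefined) w" for h w
      using na that length_replicate unfolding nonadaptive_def by metis
    then have "\<pi> = (\<lambda>h. (\<lambda>t. \<pi> (replicate t undefined)) (length h))" by (intro ext)
    then show ?thesis
      using nonadaptive_policy_star_osm_le[OF U, of v "\<lambda>t. \<pi> (replicate t undefined)"] by simp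
  qed
  have nonneg: "0 \<le> measure_pmf.expectation (run ?I \<pi> (rounds ?I)) (reward ?I)" for \<pi>
    by (rule integral_nonneg_AE) (auto simp: AE_measure_pmf_iff reward_run_bounds[OF valid])
  have "expected_alg ?I A =
      measure_pmf.expectation A (\<lambda>\<pi>. measure_pmf.expectation (run ?I \<pi> (rounds ?I)) (reward ?I))"
    unfolding expected_alg_def
    by (rule expectation_bind_pmf_bounded[where B = "real (rounds ?I) * (\<Sum>e\<in>edges ?I. weight ?I e)"])
       (auto intro: reward_run_bounds[OF valid] simp del: star_osm_simps)
  also have "\<dots> \<le> measure_pmf.expectation A (\<lambda>_. ?b)"
  proof (rule integral_mono_AE)
    show "integrable A (\<lambda>\<pi>. measure_pmf.expectation (run ?I \<pi> (rounds ?I)) (reward ?I))"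
      by (rule integrable_measure_pmf_bounded_on[where B = ?b]) (use le nonneg in auto)
  qed (use le in \<open>auto simp: AE_measure_pmf_iff\<close>)
  finally show ?thesis by simp
qed

theorem nonadaptive_ratio_le:
  fixes alg :: "('u, 'v) osm \<Rightarrow> ('u, 'v) algorithm"
  assumes inf: "infinite (UNIV :: 'u set)"
    and na: "\<And>I. valid_osm I \<Longrightarrow> nonadaptive (alg I)" and ratio: "achieves_ratio alg c"
  shows "c \<le> 1 - 1 / exp 1"
proof (rule field_le_epsilon)
  fix \<epsilon> :: real assume "0 < \<epsilon>"
  with ratio obtain N where N: "\<And>I. valid_osm I \<Longrightarrow> N \<le> rounds I \<Longrightarrow>
      (c - \<epsilon>) * expected_opt I \<le> expected_alg I (alg I)"
    unfolding achieves_ratio_def by meson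
  \<comment> \<open>Star instances of every size \<open>m\<close> exist because \<open>'u\<close> is
    infinite. Dividing by \<open>m\<close> gives a bound on \<open>c\<close> whose two sides
    converge; \<open>1 + (- 1) / real m\<close> is the shape of the exponential limit.\<close>
  have le: "(c - \<epsilon>) * (1 - 1 / (2 * sqrt (real m))) \<le> 1 - (1 + (- 1) / real m) ^ m"
    if m: "2 \<le> m" "N \<le> m" and "0 \<le> c - \<epsilon>" for m
  proof -
    obtain U :: "'u set" where U: "finite U" "card U = m"
      using infinite_arbitrarily_large[OF inf, of m] by blast
    let ?I = "star_osm U (undefined :: 'v)"
    have ne: "U \<noteq> {}" using U m by auto
    have "N \<le> m\<^sup>2" using m by (auto simp: power2_eq_square intro: le_trans)
    have "(c - \<epsilon>) * (real m - sqrt (real m) / 2) \<le> (c - \<epsilon>) * expected_opt ?I"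
      using expected_opt_star_osm_ge[OF U(1) ne] that U by (intro mult_left_mono) auto
    also have "\<dots> \<le> expected_alg ?I (alg ?I)"
      using \<open>N \<le> m\<^sup>2\<close> U ne by (intro N valid_star_osm) auto
    also have "\<dots> \<le> real m * (1 - (1 - 1 / real m) ^ m)"
      using nonadaptive_star_osm_le[OF U(1) _ na[OF valid_star_osm[OF U(1) ne]]] U m by simp
    finally have "(c - \<epsilon>) * (real m - sqrt (real m) / 2) / m \<le> 1 - (1 - 1 / real m) ^ m"
      using m by (simp add: divide_le_eq mult.commute)
    moreover have "real m - sqrt (real m) / 2 = real m * (1 - 1 / (2 * sqrt (real m)))"
      using m by (simp add: field_simps)
    ultimately show ?thesis using m by simp
  qed
  show "c \<le> 1 - 1 / exp 1 + \<epsilon>"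
  \<comment> \<open>Multiplying the lower bound on the optimum by \<open>c - \<epsilon>\<close>
    needs this sign; otherwise \<open>c\<close> is below \<epsilon> and the claim follows from
    \<open>1 / exp 1 \<le> 1\<close>.\<close>
  proof (cases "0 \<le> c - \<epsilon>")
    case True
    have "(\<lambda>m. (c - \<epsilon>) * (1 - 1 / (2 * sqrt (real m)))) \<longlonglongrightarrow> (c - \<epsilon>) * (1 - 0)"
      by (intro tendsto_intros real_tendsto_divide_at_top[OF tendsto_const]
            filterlim_tendsto_pos_mult_at_top[OF tendsto_const]
            filterlim_compose[OF sqrt_at_top filterlim_real_sequentially]) simp
    moreover have "(\<lambda>m. 1 - (1 + (- 1) / real m) ^ m) \<longlonglongrightarrow> 1 - exp (- 1)"
      by (intro tendsto_intros tendsto_exp_limit_sequentially)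
    ultimately have "(c - \<epsilon>) * (1 - 0) \<le> 1 - exp (- 1)"
      by (rule LIMSEQ_le) (use le True in \<open>auto intro!: exI[of _ "max 2 N"]\<close>)
    then show ?thesis by (simp add: exp_minus inverse_eq_divide)
  next
    case False
    moreover have "1 / exp 1 \<le> (1 :: real)" by simp
    ultimately show ?thesis by linarith
  qed
qed

theorem theorem3:
  shows "(\<forall>F :: ('u, 'v) osm \<Rightarrow> 'u \<times> 'v \<Rightarrow> real.
            (\<forall>I. valid_osm I \<longrightarrow> lp_optimal I (F I)) \<longrightarrow>
              (\<forall>I. valid_osm I \<longrightarrow> nonadaptive (SM I (F I))) \<and>
              achieves_ratio (\<lambda>I. SM I (F I)) (1 - 1 / exp 1)) \<and>
         (infinite (UNIV :: 'u set) \<and> infinite (UNIV :: 'v set) \<longrightarrow>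
            (\<forall>(alg :: ('u, 'v) osm \<Rightarrow> ('u, 'v) algorithm) c.
               (\<forall>I. valid_osm I \<longrightarrow> nonadaptive (alg I)) \<and> achieves_ratio alg c \<longrightarrow>
                 c \<le> 1 - 1 / exp 1))"
  using SM_achieves_ratio nonadaptive_ratio_le by (blast intro: nonadaptive_SM)

end
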